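(* Let $\mathcal{A}$ be an almost Kähler–Poisson algebra with curvature tensor $R$ and geometric dimension $n\geq 3$. If there is $k\in\mathcal{A}$ such that the sectional curvature satisfies $K(X,Y)=k$ for all $X,Y\in\mathcal{X}(\mathcal{A})$ for which it is defined (i.e. for which $(X,X)(Y,Y)-(X,Y)^2\neq0$), then $\{k,u\}=0$ for all $u\in\mathcal{A}$.
   Context: Repeated indices are summed from $1$ to $m$; index position (upper/lower) is immaterial. Let $\mathcal{A}$ be the field of fractions of $\mathbb{C}[x^1,\ldots,x^m]$, equipped with a Poisson structure $\{\cdot,\cdot\}$ ($\mathbb{C}$-bilinear, antisymmetric, Leibniz, Jacobi), and set $\mathcal{P}^{ij}=\{x^i,x^j\}$. $\mathcal{A}$ is a $\ast$-algebra with conjugate-linear involution determined by $(x^i)^\ast=x^i$, and it is assumed that $\{u,v\}^\ast=\{u^\ast,v^\ast\}$. $(\mathcal{A},\{\cdot,\cdot\})$ is an almost Kähler–Poisson algebra if there is an invertible hermitian element, denoted $\gamma^2\in\mathcal{A}$ (a square root need not exist), with $\mathcal{P}^{i}{}_{k}\mathcal{P}^{k}{}_{l}\mathcal{P}^{l}{}_{j}=-\gamma^2\mathcal{P}^{i}{}_{j}$. $\mathrm{Der}(\mathcal{A})$ is the $\mathcal{A}$-module of derivations generated by $\partial_i=\partial_{x^i}$, with bilinear form $(X^i\partial_i,Y^j\partial_j)=X^iY_i$. For $u\in\mathcal{A}$ put $\mathcal{D}^i(u)=\frac{1}{\gamma^2}\{u,x^k\}\mathcal{P}^{i}{}_{k}$,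 $\mathcal{D}^{ik}=\mathcal{D}^i(x^k)$, and $\mathcal{D}(X)=\mathcal{D}^{i}{}_{k}X^k\partial_i$ (a projector). $\mathcal{X}(\mathcal{A})=\{\mathcal{D}(X):X\in\mathrm{Der}(\mathcal{A})\}$ is the tangent space; its dimension over the field $\mathcal{A}$ is the geometric dimension $n$ of $\mathcal{A}$. For $X,Y\in\mathcal{X}(\mathcal{A})$: $X(u)=\nabla_X(u)=X^i\mathcal{D}_i(u)$, $\nabla_XY=\mathcal{D}^{ik}X^l\mathcal{D}_l(Y_k)\partial_i$, $[X,Y]^i=X(Y^i)-Y(X^i)$. Curvature: $R(X,Y)Z=\nabla_X\nabla_YZ-\nabla_Y\nabla_XZ-\nabla_{[X,Y]}Z$ and $R(X,Y,Z,V)=(R(Z,V)Y,X)$ for $X,Y,Z,V\in\mathcal{X}(\mathcal{A})$. The sectional curvature is $K(X,Y)=\dfrac{R(X,Y,X,Y)}{(X,X)(Y,Y)-(X,Y)^2}$. *)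

theory Defs
  imports
    "HOL-Analysis.Analysis"
    "HOL-Library.Poly_Mapping"
    "HOL-Computational_Algebra.Fraction_Field"
begin

text \<open>
  Polynomials are finitely supported functions from monomials (finitely supported exponent
  vectors) to the complex numbers. The variables are indexed by a finite type, so that \<open>m\<close> is
  the cardinality of that type. The linear order on the index type is never used in a definition;
  it is only what the library asks for to make polynomials an integral domain, and every finite
  cardinality is attained by a linearly ordered type.
\<close>

type_synonym 'm cpoly = "('m \<Rightarrow>\<^sub>0 nat) \<Rightarrow>\<^sub>0 complex"
type_synonym 'm ratfun = "'m cpoly fract"

definition scalar :: "complex \<Rightarrow> 'm::{finite,linorder} ratfun" where
  "scalar c = Fract (Poly_Mapping.single 0 c) 1"

definition coord :: "'m \<Rightarrow> 'm::{finite,linorder} ratfun" where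
  "coord i = Fract (Poly_Mapping.single (Poly_Mapping.single i 1) 1) 1"

definition poly_cnj :: "'m::{finite,linorder} cpoly \<Rightarrow> 'm cpoly" where
  "poly_cnj p = Poly_Mapping.map cnj p"

lemma lookup_poly_cnj: "Poly_Mapping.lookup (poly_cnj p) k = cnj (Poly_Mapping.lookup p k)"
  by (simp add: poly_cnj_def Poly_Mapping.map.rep_eq when_def)

lemma poly_cnj_add: "poly_cnj (p + q) = poly_cnj p + poly_cnj q"
  by (rule poly_mapping_eqI) (simp add: lookup_poly_cnj lookup_add)

lemma poly_cnj_eq_0_iff [simp]: "poly_cnj p = 0 \<longleftrightarrow> p = 0"
  by (simp add: poly_mapping_eq_iff fun_eq_iff lookup_poly_cnj)

lemma poly_cnj_single [simp]:
  "poly_cnj (Poly_Mapping.single k c) = Poly_Mapping.single k (cnj c)"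
  by (rule poly_mapping_eqI) (simp add: lookup_poly_cnj lookup_single when_def)

lemma poly_cnj_poly_cnj [simp]: "poly_cnj (poly_cnj p) = p"
  by (rule poly_mapping_eqI) (simp add: lookup_poly_cnj)

lemma cnj_Sum_any: "cnj (Sum_any f) = Sum_any (\<lambda>x. cnj (f x))"
  by (simp add: Sum_any.expand_set cnj_sum)

lemma poly_cnj_mult: "poly_cnj (p * q) = poly_cnj p * poly_cnj q"
proof (rule poly_mapping_eqI)
  fix k
  have cnj_when: "cnj (a when P) = (cnj a when P)" for a P
    by (simp add: when_def)
  show "Poly_Mapping.lookup (poly_cnj (p * q)) k = Poly_Mapping.lookup (poly_cnj p * poly_cnj q) k"
    by (simp add: lookup_mult lookup_poly_cnj cnj_Sum_any cnj_when)
qed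

lift_definition star :: "'m::{finite,linorder} ratfun \<Rightarrow> 'm ratfun"
  is "\<lambda>q. (poly_cnj (fst q), poly_cnj (snd q))"
  by (auto simp: poly_cnj_mult [symmetric])

lemma star_Fract: "b \<noteq> 0 \<Longrightarrow> star (Fract a b) = Fract (poly_cnj a) (poly_cnj b)"
  by transfer (simp add: poly_cnj_mult)

lemma star_add: "star (u + v) = star u + star v"
  by (cases u, cases v) (simp add: star_Fract poly_cnj_add poly_cnj_mult)

lemma star_mult: "star (u * v) = star v * star u"
  by (cases u, cases v) (simp add: star_Fract poly_cnj_mult mult.commute)

lemma poly_cnj_1 [simp]: "poly_cnj 1 = 1"
  unfolding single_one [symmetric] by (simp del: single_one)

lemma star_scalar: "star (scalar c) = scalar (cnj c)"
  by (simp add: scalar_def star_Fract)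

lemma star_coord: "star (coord i) = coord i"
  by (simp add: coord_def star_Fract)

lemma star_star: "star (star u) = u"
  by (cases u) (simp add: star_Fract)


text \<open>
  An element \<open>X\<^sup>i\<partial>\<^sub>i\<close> of \<open>Der(\<A>)\<close> is represented by the vector of its components in the
  basis \<open>\<partial>\<^sub>i\<close> of \<open>Der(\<A>)\<close> over \<open>\<A>\<close>.
\<close>

type_synonym 'm vfield = "('m ratfun, 'm) vec"

definition form :: "'m::{finite,linorder} vfield \<Rightarrow> 'm vfield \<Rightarrow> 'm ratfun" where
  "form X Y = (\<Sum>i\<in>UNIV. X $ i * Y $ i)"

definition gram :: "'m::{finite,linorder} vfield \<Rightarrow> 'm vfield \<Rightarrow> 'm ratfun" where
  "gram X Y = form X X * form Y Y - (form X Y)\<^sup>2"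

text \<open>
  Linearity in the second argument and the Leibniz rule in the first one follow by antisymmetry.
\<close>

locale poisson_ratfun =
  fixes br :: "'m::{finite,linorder} ratfun \<Rightarrow> 'm ratfun \<Rightarrow> 'm ratfun"
  assumes br_add: "br (u + v) w = br u w + br v w"
    and br_scalar: "br (scalar c * u) w = scalar c * br u w"
    and br_antisym: "br u v = - br v u"
    and br_leibniz: "br u (v * w) = br u v * w + v * br u w"
    and br_jacobi: "br u (br v w) + br v (br w u) + br w (br u v) = 0"
    and br_star: "star (br u v) = br (star u) (star v)"
begin

definition PP :: "'m \<Rightarrow> 'm \<Rightarrow> 'm ratfun" where
  "PP i j = br (coord i) (coord j)"

end

text \<open>
  \<open>gamma2\<close> is the element written \<open>\<gamma>\<^sup>2\<close>; it need not be a square. It is fixed as part of the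
  data, so statements about the locale hold for every admissible choice of it.
\<close>

locale almost_kaehler_poisson = poisson_ratfun br
  for br :: "'m::{finite,linorder} ratfun \<Rightarrow> 'm ratfun \<Rightarrow> 'm ratfun" +
  fixes gamma2 :: "'m ratfun"
  assumes gamma2_invertible: "gamma2 \<noteq> 0"
    and gamma2_hermitian: "star gamma2 = gamma2"
    and PP_cubed: "(\<Sum>k\<in>UNIV. \<Sum>l\<in>UNIV. PP i k * PP k l * PP l j) = - gamma2 * PP i j"
begin

definition DD :: "'m \<Rightarrow> 'm ratfun \<Rightarrow> 'm ratfun" where
  "DD i u = 1 / gamma2 * (\<Sum>k\<in>UNIV. br u (coord k) * PP i k)"

definition DD2 :: "'m \<Rightarrow> 'm \<Rightarrow> 'm ratfun" where
  "DD2 i k = DD i (coord k)"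

definition proj :: "'m vfield \<Rightarrow> 'm vfield" where
  "proj X = (\<chi> i. \<Sum>k\<in>UNIV. DD2 i k * X $ k)"

definition tangent :: "'m vfield set" where
  "tangent = range proj"

definition geometric_dim :: nat where
  "geometric_dim = vec.dim tangent"

definition nabla_fun :: "'m vfield \<Rightarrow> 'm ratfun \<Rightarrow> 'm ratfun" where
  "nabla_fun X u = (\<Sum>i\<in>UNIV. X $ i * DD i u)"

definition nabla :: "'m vfield \<Rightarrow> 'm vfield \<Rightarrow> 'm vfield" where
  "nabla X Y = (\<chi> i. \<Sum>k\<in>UNIV. \<Sum>l\<in>UNIV. DD2 i k * X $ l * DD l (Y $ k))"

definition bracket :: "'m vfield \<Rightarrow> 'm vfield \<Rightarrow> 'm vfield" where
  "bracket X Y = (\<chi> i. nabla_fun X (Y $ i) - nabla_fun Y (X $ i))"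

definition curvature ::
    "'m vfield \<Rightarrow> 'm vfield \<Rightarrow> 'm vfield \<Rightarrow> 'm vfield" where
  "curvature X Y Z = nabla X (nabla Y Z) - nabla Y (nabla X Z) - nabla (bracket X Y) Z"

definition curvature4 ::
    "'m vfield \<Rightarrow> 'm vfield \<Rightarrow> 'm vfield \<Rightarrow> 'm vfield \<Rightarrow> 'm ratfun" where
  "curvature4 X Y Z V = form (curvature Z V Y) X"

definition sectional :: "'m vfield \<Rightarrow> 'm vfield \<Rightarrow> 'm ratfun" where
  "sectional X Y = curvature4 X Y X Y / gram X Y"

end

end

theory Submission
  imports Defs
begin

text \<open>
  The argument is Schur's lemma, carried out along the symplectic leaves in the language of
  derivations. Three things make this possible.

  First, \<open>proj\<close> is the orthogonal projector onto the tangent space, and the tangent space is spanned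
  by the Hamiltonian fields \<open>u \<mapsto> {u, x\<^sup>a}\<close>. By the Jacobi identity it is therefore closed under the
  bracket of vector fields (\<open>tangent_bracket\<close>): the leaves are integrable. The connection is the
  projected directional derivative, so, as for a submanifold of Euclidean space, it is metric and
  torsion-free, and its curvature has all the usual symmetries and satisfies both Bianchi identities.
  Identities between derivations reduce to the coordinate functions, because a derivation of the
  field of rational functions is determined by its values there (\<open>derivation_eq_zero\<close>).

  Secondly, the bilinear form is nondegenerate on the tangent space, although a single vector may be
  isotropic since the scalars contain the imaginary unit. The sectional curvature only sees planes
  with nonzero Gram determinant; these are Zariski dense, so the identity
  \<open>(R(X,Y)Y, X) = k gram X Y\<close> extends to all pairs (\<open>sectional_identity_dense\<close>), and polarization turns it
  into \<open>R(X,Y)Z = k ((Y,Z) X - (X,Z) Y)\<close> (\<open>curvature_of_constant_sectional\<close>).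

  Thirdly, inserting this into the second Bianchi identity leaves only derivatives of \<open>k\<close>
  (\<open>schur_cyclic\<close>). With three independent tangent vectors available, comparing coefficients gives
  \<open>X(k) = 0\<close> for every tangent \<open>X\<close>; for \<open>X\<close> Hamiltonian this says \<open>{k, x\<^sup>a} = 0\<close>, and \<open>{k, u}\<close> is a
  combination of these brackets.
\<close>

section \<open>Rational functions and their derivations\<close>

instance fract :: ("{idom, ring_char_0}") field_char_0
proof
  show "inj (of_nat :: nat \<Rightarrow> 'a fract)"
    by (auto intro!: injI simp: of_nat_fract eq_fract)
qed

lemma monomial_in_mult_closed_set:
  fixes K :: "'m::{finite,linorder} cpoly set"
  assumes const: "\<And>c. Poly_Mapping.single 0 c \<in> K"
    and var: "\<And>i. Poly_Mapping.single (Poly_Mapping.single i 1) 1 \<in> K"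
    and mult: "\<And>f g. f \<in> K \<Longrightarrow> g \<in> K \<Longrightarrow> f * g \<in> K"
  shows "Poly_Mapping.single m c \<in> K"
proof -
  have power: "Poly_Mapping.single (Poly_Mapping.single i n) 1 \<in> K" for i n
  proof (induction n)
    case 0
    show ?case using const[of 1] by simp
  next
    case (Suc n)
    have "Poly_Mapping.single (Poly_Mapping.single i (Suc n)) (1::complex) =
      Poly_Mapping.single (Poly_Mapping.single i 1) 1 * Poly_Mapping.single (Poly_Mapping.single i n) 1"
      by (simp add: mult_single single_add[symmetric])
    then show ?case using mult[OF var Suc] by simp
  qed
  have "Poly_Mapping.single m 1 \<in> K"
  proof (induction m rule: update_induct)
    case const
    show ?case using assms(1)[of 1] by simp
  next
    case (update m i n)
    have "Poly_Mapping.update i n m = Poly_Mapping.single i n + m"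
      using update(1)
      by (intro poly_mapping_eqI)
         (auto simp: lookup_add lookup_update lookup_single when_def in_keys_iff)
    then have "Poly_Mapping.single (Poly_Mapping.update i n m) (1::complex) =
      Poly_Mapping.single (Poly_Mapping.single i n) 1 * Poly_Mapping.single m 1"
      by (simp add: mult_single)
    then show ?case using mult[OF power update(3)] by simp
  qed
  then have "Poly_Mapping.single 0 c * Poly_Mapping.single m 1 \<in> K"
    by (intro mult const)
  then show ?thesis by (simp add: mult_single)
qed

lemma cpoly_in_subalgebra:
  fixes K :: "'m::{finite,linorder} cpoly set"
  assumes const: "\<And>c. Poly_Mapping.single 0 c \<in> K"
    and var: "\<And>i. Poly_Mapping.single (Poly_Mapping.single i 1) 1 \<in> K"
    and add: "\<And>f g. f \<in> K \<Longrightarrow> g \<in> K \<Longrightarrow> f + g \<in> K"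
    and mult: "\<And>f g. f \<in> K \<Longrightarrow> g \<in> K \<Longrightarrow> f * g \<in> K"
  shows "f \<in> K"
proof (induction f rule: update_induct)
  case const
  show ?case using assms(1)[of 0] by simp
next
  case (update f m c)
  have "Poly_Mapping.update m c f = Poly_Mapping.single m c + f"
    using update(1)
    by (intro poly_mapping_eqI)
       (auto simp: lookup_add lookup_update lookup_single when_def in_keys_iff)
  then show ?case
    using add[OF monomial_in_mult_closed_set[OF const var mult] update(3)] by simp
qed

text \<open>
  The polynomials killed by a derivation that annihilates constants form a subalgebra, which contains
  the variables and hence everything; the product rule for \<open>(a / b) b = a\<close> then settles fractions.
  Identities between derivations can thus be checked on coordinates, without partial derivatives.
\<close>

lemma derivation_eq_zero:
  fixes d :: "'m::{finite,linorder} ratfun \<Rightarrow> 'm ratfun"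
  assumes add: "\<And>u v. d (u + v) = d u + d v"
    and leibniz: "\<And>u v. d (u * v) = d u * v + u * d v"
    and scalar: "\<And>c. d (scalar c) = 0"
    and coord: "\<And>i. d (coord i) = 0"
  shows "d u = 0"
proof (cases u)
  case (Fract a b)
  have poly: "d (Fract f 1) = 0" for f
  proof -
    have "f \<in> {f. d (Fract f 1) = 0}"
    proof (rule cpoly_in_subalgebra)
      fix f g assume fg: "f \<in> {f. d (Fract f 1) = 0}" "g \<in> {f. d (Fract f 1) = 0}"
      show "f + g \<in> {f. d (Fract f 1) = 0}"
        using fg add[of "Fract f 1" "Fract g 1"] by simp
      show "f * g \<in> {f. d (Fract f 1) = 0}"
        using fg leibniz[of "Fract f 1" "Fract g 1"] by simp
    qed (use scalar coord in \<open>simp_all add: scalar_def coord_def\<close>)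
    then show ?thesis by simp
  qed
  have "u * Fract b 1 = Fract a 1"
    using Fract by (simp add: eq_fract)
  then have "d u * Fract b 1 + u * d (Fract b 1) = d (Fract a 1)"
    by (metis leibniz)
  then have "d u * Fract b 1 = 0" by (simp add: poly)
  moreover have "Fract b 1 \<noteq> 0" using Fract by (simp add: Zero_fract_def eq_fract)
  ultimately show ?thesis by simp
qed

section \<open>Multilinear algebra\<close>

text \<open>
  Density of the complement of the zeros of a nonzero polynomial: the product of the two quadratics
  vanishes at every point of an infinite field, so it is the zero polynomial.
\<close>

lemma quadratic_vanishing_off_zeros:
  fixes a b c a' b' c' :: "'a::field_char_0"
  assumes "c' \<noteq> 0"
    and "\<And>t. a' + b' * t + c' * t\<^sup>2 \<noteq> 0 \<Longrightarrow> a + b * t + c * t\<^sup>2 = 0"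
  shows "a = 0"
proof -
  have eval: "poly [:p, q, r:] t = p + q * t + r * t\<^sup>2" for p q r t :: 'a
    by (simp add: power2_eq_square algebra_simps)
  have "poly ([:a', b', c':] * [:a, b, c:]) t = 0" for t
    unfolding poly_mult eval using assms(2)[of t] by auto
  then have "[:a', b', c':] * [:a, b, c:] = 0"
    using poly_all_0_iff_0 by blast
  then have "[:a, b, c:] = 0" using assms(1) by auto
  then show ?thesis by simp
qed

text \<open>
  Polarization. The two antisymmetries and the cyclic identity imply the pair symmetry, which makes
  \<open>B X Y Y V\<close> symmetric in \<open>X\<close> and \<open>V\<close>, so that it vanishes with its diagonal values. Then
  \<open>B\<close> is also antisymmetric in its two middle arguments, and the cyclic sum becomes \<open>3 B X Y Z V\<close>.
  The set \<open>S\<close> takes the place of the tangent space, which is only a part of the type of vectors.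
\<close>

lemma curvature_tensor_eq_zero:
  fixes B :: "'v::ab_group_add \<Rightarrow> 'v \<Rightarrow> 'v \<Rightarrow> 'v \<Rightarrow> 'a::field_char_0"
  assumes S_add: "\<And>X Y. X \<in> S \<Longrightarrow> Y \<in> S \<Longrightarrow> X + Y \<in> S"
    and add2: "\<And>X Y Y' Z V. X \<in> S \<Longrightarrow> Y \<in> S \<Longrightarrow> Y' \<in> S \<Longrightarrow> Z \<in> S \<Longrightarrow> V \<in> S \<Longrightarrow>
      B X (Y + Y') Z V = B X Y Z V + B X Y' Z V"
    and add3: "\<And>X Y Z Z' V. X \<in> S \<Longrightarrow> Y \<in> S \<Longrightarrow> Z \<in> S \<Longrightarrow> Z' \<in> S \<Longrightarrow> V \<in> S \<Longrightarrow>
      B X Y (Z + Z') V = B X Y Z V + B X Y Z' V"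
    and skew12: "\<And>X Y Z V. X \<in> S \<Longrightarrow> Y \<in> S \<Longrightarrow> Z \<in> S \<Longrightarrow> V \<in> S \<Longrightarrow>
      B Y X Z V = - B X Y Z V"
    and skew34: "\<And>X Y Z V. X \<in> S \<Longrightarrow> Y \<in> S \<Longrightarrow> Z \<in> S \<Longrightarrow> V \<in> S \<Longrightarrow>
      B X Y V Z = - B X Y Z V"
    and cyclic: "\<And>X Y Z V. X \<in> S \<Longrightarrow> Y \<in> S \<Longrightarrow> Z \<in> S \<Longrightarrow> V \<in> S \<Longrightarrow>
      B X Y Z V + B Y Z X V + B Z X Y V = 0"
    and sectional: "\<And>X Y. X \<in> S \<Longrightarrow> Y \<in> S \<Longrightarrow> B X Y Y X = 0"
    and S: "X \<in> S" "Y \<in> S" "Z \<in> S" "V \<in> S"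
  shows "B X Y Z V = 0"
proof -
  have pair: "B Z V X Y = B X Y Z V" if S: "X \<in> S" "Y \<in> S" "Z \<in> S" "V \<in> S" for X Y Z V
  proof -
    note cyc = cyclic[OF S(1) S(2) S(3) S(4)] cyclic[OF S(2) S(3) S(4) S(1)]
      cyclic[OF S(3) S(4) S(1) S(2)] cyclic[OF S(4) S(1) S(2) S(3)]
    have "B Y Z V X = - B Y Z X V" "B Z V Y X = - B Z V X Y" "B X Y V Z = - B X Y Z V"
      "B V X Z Y = - B V X Y Z"
      using S by (blast intro: skew34)+
    moreover have "B X Z V Y = B Z X Y V"
      using skew12[OF S(3) S(1) S(4) S(2)] skew34[OF S(3) S(1) S(2) S(4)] by (metis minus_minus)
    moreover have "B Y V X Z = B V Y Z X"
      using skew12[OF S(4) S(2) S(1) S(3)] skew34[OF S(4) S(2) S(3) S(1)] by (metis minus_minus)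
    ultimately have "2 * B Z V X Y = 2 * B X Y Z V" using cyc by algebra
    then show ?thesis by simp
  qed
  have diag: "B X Y Y V = 0" if S: "X \<in> S" "Y \<in> S" "V \<in> S" for X Y V
  proof -
    have "B Y X X Y + B Y X V Y + B Y V X Y + B Y V V Y = B Y (X + V) (X + V) Y"
      using S S_add by (simp add: add2 add3)
    then have "B Y X X Y + B Y X V Y + B Y V X Y + B Y V V Y = 0"
      using S S_add by (simp add: sectional)
    moreover have "B Y X X Y = 0" "B Y V V Y = 0"
      using S by (auto intro!: sectional)
    moreover have "B Y V X Y = B Y X V Y"
      using pair[OF S(2,1,3,2)] skew12[OF S(2,3,2,1)] skew34[OF S(2,3,1,2)]
      by (metis minus_minus)
    moreover have "B Y X V Y = B X Y Y V"
      using skew12[OF S(2,1,3,2)] skew34[OF S(1,2,2,3)] by (metis minus_minus)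
    ultimately have "2 * B X Y Y V = 0" by algebra
    then show ?thesis by simp
  qed
  have skew23: "B X Z Y V = - B X Y Z V" if S: "X \<in> S" "Y \<in> S" "Z \<in> S" "V \<in> S" for X Y Z V
  proof -
    have "B X Y Y V + B X Y Z V + B X Z Y V + B X Z Z V = B X (Y + Z) (Y + Z) V"
      using S S_add by (simp add: add2 add3)
    then show ?thesis
      using diag[OF S(1,2,4)] diag[OF S(1,3,4)] diag[OF S(1) S_add[OF S(2,3)] S(4)]
      by (simp add: eq_neg_iff_add_eq_0 add.commute)
  qed
  have "B Y Z X V = B X Y Z V"
    using skew12[OF S] skew23[OF S(2,1,3,4)] by (metis minus_minus)
  moreover have "B Z X Y V = B X Y Z V"
    using skew23[OF S] skew12[OF S(1,3,2,4)] by (metis minus_minus)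
  moreover have "3 * B X Y Z V = B X Y Z V + B X Y Z V + B X Y Z V"
    by simp
  ultimately have "3 * B X Y Z V = 0"
    using cyclic[OF S] by metis
  then show ?thesis by simp
qed

lemma form_commute: "form X Y = form Y X"
  by (simp add: form_def mult.commute)

lemma form_add_left: "form (X + X') Y = form X Y + form X' Y"
  by (simp add: form_def algebra_simps sum.distrib)

lemma form_add_right: "form X (Y + Y') = form X Y + form X Y'"
  by (simp add: form_def algebra_simps sum.distrib)

lemma form_diff_left: "form (X - X') Y = form X Y - form X' Y"
  by (simp add: form_def algebra_simps sum_subtractf)

lemma form_diff_right: "form X (Y - Y') = form X Y - form X Y'"
  by (simp add: form_def algebra_simps sum_subtractf)

lemma form_scale_left: "form (f *s X) Y = f * form X Y"
  by (simp add: form_def sum_distrib_left mult.assoc)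

lemma form_scale_right: "form X (f *s Y) = f * form X Y"
  by (simp add: form_def sum_distrib_left mult.left_commute)

lemma form_zero [simp]: "form 0 Y = 0" "form X 0 = 0"
  by (simp_all add: form_def)

lemma form_axis: "form X (axis i 1) = X $ i"
  by (simp add: form_def axis_def if_distrib cong: if_cong)

lemmas form_linear = form_add_left form_add_right form_diff_left form_diff_right
  form_scale_left form_scale_right

section \<open>Calculus along the symplectic leaves\<close>

context poisson_ratfun
begin

lemma br_add_right: "br u (v + w) = br u v + br u w"
  unfolding br_antisym[of u] br_add by simp

lemma br_leibniz_left: "br (u * v) w = br u w * v + u * br v w"
  unfolding br_antisym[of _ w] br_leibniz by simp

lemma br_scalar_left: "br (scalar c) w = 0"
proof -
  have "br 1 w = 0"
    using br_leibniz_left[of 1 1 w] by simp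
  then show ?thesis using br_scalar[of c 1 w] by simp
qed

lemma br_scalar_right: "br w (scalar c) = 0"
  using br_antisym[of w] br_scalar_left by simp

lemma br_minus_right: "br u (- v) = - br u v"
proof -
  have "br u 0 = 0" using br_add_right[of u 0 0] by simp
  then show ?thesis using br_add_right[of u v "- v"] by (simp add: add_eq_0_iff)
qed

lemma PP_antisym: "PP i j = - PP j i"
  unfolding PP_def by (rule br_antisym)

end

context almost_kaehler_poisson
begin

lemma DD2_eq: "DD2 i j = (\<Sum>l\<in>UNIV. PP i l * PP j l) / gamma2"
  unfolding DD2_def DD_def PP_def[symmetric] by (simp add: mult.commute)

lemma DD2_sym: "DD2 i j = DD2 j i"
  by (simp add: DD2_eq mult.commute)

text \<open>
  This is the defining cubic identity: up to the factor \<open>- gamma2\<close>, the matrix \<open>DD2\<close> is the square of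
  \<open>PP\<close>. It makes \<open>DD2\<close> idempotent and puts the columns of \<open>PP\<close> in the range of the projector.
\<close>

lemma DD2_PP: "(\<Sum>k\<in>UNIV. DD2 i k * PP k j) = PP i j"
proof -
  have "DD2 i k = - (\<Sum>l\<in>UNIV. PP i l * PP l k) / gamma2" for k
    unfolding DD2_eq sum_negf[symmetric] PP_antisym[of k] by simp
  then have "(\<Sum>k\<in>UNIV. DD2 i k * PP k j) =
      - (\<Sum>k\<in>UNIV. \<Sum>l\<in>UNIV. PP i l * PP l k * PP k j) / gamma2"
    by (simp add: sum_distrib_right sum_negf sum_divide_distrib)
  also have "\<dots> = - (\<Sum>l\<in>UNIV. \<Sum>k\<in>UNIV. PP i l * PP l k * PP k j) / gamma2"
    by (subst sum.swap) simp
  finally show ?thesis by (simp add: PP_cubed gamma2_invertible)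
qed

lemma DD2_idem: "(\<Sum>k\<in>UNIV. DD2 i k * DD2 k j) = DD2 i j"
proof -
  have "(\<Sum>k\<in>UNIV. DD2 i k * DD2 k j) =
      (\<Sum>k\<in>UNIV. \<Sum>l\<in>UNIV. DD2 i k * PP k l * PP j l) / gamma2"
    by (simp add: DD2_eq[of k j for k] sum_distrib_left sum_divide_distrib mult.assoc)
  also have "\<dots> = (\<Sum>l\<in>UNIV. (\<Sum>k\<in>UNIV. DD2 i k * PP k l) * PP j l) / gamma2"
    by (subst sum.swap) (simp add: sum_distrib_right)
  finally show ?thesis by (simp add: DD2_PP flip: DD2_eq)
qed

text \<open>
  The Hamiltonian vector of every \<open>u\<close>, not only of a coordinate, is fixed by the projector. For \<open>u\<close> a
  coordinate this is \<open>DD2_PP\<close>, and both sides are derivations in \<open>u\<close>.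
\<close>

lemma br_coord_DD2: "(\<Sum>k\<in>UNIV. br u (coord k) * DD2 k j) = br u (coord j)"
proof -
  define d where "d u = (\<Sum>k\<in>UNIV. br u (coord k) * DD2 k j) - br u (coord j)" for u
  have "d u = 0"
  proof (rule derivation_eq_zero[of d])
    show "d (u + v) = d u + d v" for u v
      by (simp add: d_def br_add algebra_simps sum.distrib)
    show "d (u * v) = d u * v + u * d v" for u v
      by (simp add: d_def br_leibniz_left algebra_simps sum.distrib sum_distrib_left)
    show "d (coord i) = 0" for i
    proof -
      have "(\<Sum>k\<in>UNIV. PP i k * DD2 k j) = - (\<Sum>k\<in>UNIV. DD2 j k * PP k i)"
        unfolding PP_antisym[of i] DD2_sym[of j] by (simp add: sum_negf mult.commute)
      then show ?thesis
        by (simp add: d_def DD2_PP PP_antisym[of i j] flip: PP_def)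
    qed
  qed (simp add: d_def br_scalar_left)
  then show ?thesis by (simp add: d_def)
qed

lemma DD_add: "DD i (u + v) = DD i u + DD i v"
  by (simp add: DD_def br_add algebra_simps sum.distrib add_divide_distrib)

lemma DD_mult: "DD i (u * v) = DD i u * v + u * DD i v"
  by (simp add: DD_def br_leibniz_left algebra_simps sum.distrib sum_distrib_left add_divide_distrib)

lemma DD_scalar: "DD i (scalar c) = 0"
  by (simp add: DD_def br_scalar_left)

text \<open>
  The Poisson bracket only differentiates along the leaves. For \<open>w\<close> a coordinate the equation is
  \<open>br_coord_DD2\<close>; both sides are derivations in \<open>w\<close>.
\<close>

lemma br_DD: "br u w = (\<Sum>j\<in>UNIV. br u (coord j) * DD j w)"
proof -
  define d where "d w = (\<Sum>j\<in>UNIV. br u (coord j) * DD j w) - br u w" for w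
  have "d w = 0"
  proof (rule derivation_eq_zero[of d])
    show "d (v + w) = d v + d w" for v w
      by (simp add: d_def br_add_right DD_add algebra_simps sum.distrib)
    show "d (v * w) = d v * w + v * d w" for v w
      by (simp add: d_def br_leibniz DD_mult algebra_simps sum.distrib sum_distrib_left)
    show "d (coord i) = 0" for i
      by (simp add: d_def br_coord_DD2 flip: DD2_def)
  qed (simp add: d_def br_scalar_right DD_scalar)
  then show ?thesis by (simp add: d_def)
qed

lemma nabla_fun_add_left: "nabla_fun (X + Y) u = nabla_fun X u + nabla_fun Y u"
  by (simp add: nabla_fun_def algebra_simps sum.distrib)

lemma nabla_fun_scale_left: "nabla_fun (f *s X) u = f * nabla_fun X u"
  by (simp add: nabla_fun_def mult.assoc sum_distrib_left)

lemma nabla_fun_add: "nabla_fun X (u + v) = nabla_fun X u + nabla_fun X v"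
  by (simp add: nabla_fun_def DD_add algebra_simps sum.distrib)

lemma nabla_fun_mult: "nabla_fun X (u * v) = nabla_fun X u * v + u * nabla_fun X v"
  by (simp add: nabla_fun_def DD_mult algebra_simps sum.distrib sum_distrib_left)

lemma nabla_fun_scalar: "nabla_fun X (scalar c) = 0"
  by (simp add: nabla_fun_def DD_scalar)

lemma nabla_fun_zero [simp]: "nabla_fun X 0 = 0"
  using nabla_fun_add[of X 0 0] by simp

lemma nabla_fun_minus: "nabla_fun X (- u) = - nabla_fun X u"
  using nabla_fun_add[of X u "- u"] by (simp add: add_eq_0_iff)

lemma nabla_fun_diff: "nabla_fun X (u - v) = nabla_fun X u - nabla_fun X v"
  using nabla_fun_add[of X u "- v"] by (simp add: nabla_fun_minus)

lemma nabla_fun_sum: "nabla_fun X (sum f A) = (\<Sum>a\<in>A. nabla_fun X (f a))"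
  by (induction A rule: infinite_finite_induct) (simp_all add: nabla_fun_add)

lemma nabla_fun_coord: "nabla_fun X (coord i) = proj X $ i"
  by (simp add: nabla_fun_def proj_def DD2_sym[of i] mult.commute flip: DD2_def)

lemma proj_add: "proj (X + Y) = proj X + proj Y"
  by (simp add: proj_def vec_eq_iff algebra_simps sum.distrib)

lemma proj_diff: "proj (X - Y) = proj X - proj Y"
  by (simp add: proj_def vec_eq_iff algebra_simps sum_subtractf)

lemma proj_scale: "proj (f *s X) = f *s proj X"
  by (simp add: proj_def vec_eq_iff sum_distrib_left mult.left_commute)

lemma proj_proj: "proj (proj X) = proj X"
proof -
  have "(\<Sum>k\<in>UNIV. DD2 i k * (\<Sum>j\<in>UNIV. DD2 k j * X $ j)) = (\<Sum>j\<in>UNIV. DD2 i j * X $ j)" for i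
  proof -
    have "(\<Sum>k\<in>UNIV. DD2 i k * (\<Sum>j\<in>UNIV. DD2 k j * X $ j)) =
        (\<Sum>j\<in>UNIV. \<Sum>k\<in>UNIV. DD2 i k * DD2 k j * X $ j)"
      by (subst sum.swap) (simp add: sum_distrib_left mult.assoc)
    also have "\<dots> = (\<Sum>j\<in>UNIV. (\<Sum>k\<in>UNIV. DD2 i k * DD2 k j) * X $ j)"
      by (simp only: sum_distrib_right)
    finally show ?thesis by (simp add: DD2_idem)
  qed
  then show ?thesis by (simp add: proj_def vec_eq_iff)
qed

lemma form_proj: "form (proj X) Y = form X (proj Y)"
proof -
  have "form (proj X) Y = (\<Sum>i\<in>UNIV. \<Sum>k\<in>UNIV. DD2 i k * X $ k * Y $ i)"
    by (simp add: form_def proj_def sum_distrib_right)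
  also have "\<dots> = (\<Sum>k\<in>UNIV. \<Sum>i\<in>UNIV. DD2 i k * X $ k * Y $ i)"
    by (rule sum.swap)
  also have "\<dots> = form X (proj Y)"
    unfolding form_def proj_def
    by (simp add: sum_distrib_left mult_ac) (simp add: DD2_sym)
  finally show ?thesis .
qed

lemma tangent_iff: "X \<in> tangent \<longleftrightarrow> proj X = X"
proof
  show "proj X = X" if "X \<in> tangent"
    using that by (auto simp: tangent_def proj_proj)
  show "X \<in> tangent" if "proj X = X"
    unfolding tangent_def by (rule range_eqI) (rule that[symmetric])
qed

lemma tangent_proj: "proj X \<in> tangent"
  by (simp add: tangent_iff proj_proj)

lemma tangent_add: "X \<in> tangent \<Longrightarrow> Y \<in> tangent \<Longrightarrow> X + Y \<in> tangent"
  by (simp add: tangent_iff proj_add)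

lemma tangent_diff: "X \<in> tangent \<Longrightarrow> Y \<in> tangent \<Longrightarrow> X - Y \<in> tangent"
  by (simp add: tangent_iff proj_diff)

lemma tangent_scale: "X \<in> tangent \<Longrightarrow> f *s X \<in> tangent"
  by (simp add: tangent_iff proj_scale)

lemma tangent_zero: "0 \<in> tangent"
  using tangent_scale[of "proj 0" 0] tangent_proj by simp

text \<open>
  The form is nondegenerate on the range of an orthogonal projector, because the ambient form is: pair
  \<open>X\<close> with the projections of the coordinate axes.
\<close>

lemma form_tangent_eq_zero:
  assumes "X \<in> tangent" "\<And>Y. Y \<in> tangent \<Longrightarrow> form X Y = 0"
  shows "X = 0"
proof -
  have "X $ i = 0" for i
  proof -
    have "form X (proj (axis i 1)) = 0" by (intro assms tangent_proj)
    then have "form X (axis i 1) = 0"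
      using assms(1) by (simp add: tangent_iff flip: form_proj)
    then show ?thesis by (simp add: form_axis)
  qed
  then show ?thesis by (simp add: vec_eq_iff)
qed

definition hamiltonian :: "'m \<Rightarrow> 'm vfield" where
  "hamiltonian a = (\<chi> i. PP i a)"

lemma tangent_hamiltonian: "hamiltonian a \<in> tangent"
  by (simp add: tangent_iff hamiltonian_def proj_def DD2_PP)

lemma nabla_fun_hamiltonian: "nabla_fun (hamiltonian a) u = br u (coord a)"
proof -
  have "br (coord a) u = - nabla_fun (hamiltonian a) u"
    unfolding br_DD[of _ u] nabla_fun_def hamiltonian_def PP_def[symmetric] PP_antisym[of a]
    by (simp add: sum_negf)
  then show ?thesis using br_antisym[of u "coord a"] by simp
qed

lemma tangent_subset_span_hamiltonian: "tangent \<subseteq> vec.span (range hamiltonian)"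
proof
  fix X assume "X \<in> tangent"
  \<comment> \<open>Read off from \<open>X = proj X\<close> with the projector written as \<open>PP\<close> times its transpose over \<open>gamma2\<close>.\<close>
  define c where "c l = (\<Sum>k\<in>UNIV. PP k l * X $ k) / gamma2" for l
  have "X $ i = (\<Sum>l\<in>UNIV. c l *s hamiltonian l) $ i" for i
  proof -
    have "X $ i = (\<Sum>k\<in>UNIV. DD2 i k * X $ k)"
      using \<open>X \<in> tangent\<close> by (simp add: tangent_iff proj_def vec_eq_iff)
    also have "\<dots> = (\<Sum>k\<in>UNIV. \<Sum>l\<in>UNIV. PP i l * PP k l * X $ k) / gamma2"
      by (simp add: DD2_eq sum_distrib_right sum_divide_distrib)
    also have "\<dots> = (\<Sum>l\<in>UNIV. \<Sum>k\<in>UNIV. PP i l * PP k l * X $ k) / gamma2"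
      by (subst sum.swap) simp
    also have "\<dots> = (\<Sum>l\<in>UNIV. c l *s hamiltonian l) $ i"
      by (simp add: c_def hamiltonian_def sum_distrib_left sum_divide_distrib mult_ac)
    finally show ?thesis .
  qed
  then have "X = (\<Sum>l\<in>UNIV. c l *s hamiltonian l)" by (simp add: vec_eq_iff)
  then show "X \<in> vec.span (range hamiltonian)"
    by (simp add: vec.span_sum vec.span_scale vec.span_base)
qed

lemma hamiltonian_induct [consumes 1, case_names hamiltonian add scale]:
  assumes "X \<in> tangent"
    and ham: "\<And>a. P (hamiltonian a)"
    and add: "\<And>X Y. X \<in> tangent \<Longrightarrow> Y \<in> tangent \<Longrightarrow> P X \<Longrightarrow> P Y \<Longrightarrow> P (X + Y)"
    and scale: "\<And>f X. X \<in> tangent \<Longrightarrow> P X \<Longrightarrow> P (f *s X)"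
  shows "P X"
proof -
  have zero: "P 0" using scale[OF tangent_hamiltonian ham, of 0] by simp
  have "X \<in> vec.span (range hamiltonian)"
    using assms(1) tangent_subset_span_hamiltonian by blast
  then have "X \<in> tangent \<and> P X"
    by (induction rule: vec.span_induct_alt)
       (auto intro: tangent_zero zero tangent_add tangent_scale tangent_hamiltonian ham add scale)
  then show ?thesis by simp
qed

lemma bracket_swap: "bracket Y X = - bracket X Y"
  by (simp add: bracket_def vec_eq_iff)

lemma bracket_add_left: "bracket (X + X') Y = bracket X Y + bracket X' Y"
  by (simp add: bracket_def vec_eq_iff nabla_fun_add nabla_fun_add_left)

lemma bracket_scale_left: "bracket (f *s X) Y = f *s bracket X Y - nabla_fun Y f *s X"
  by (simp add: bracket_def vec_eq_iff nabla_fun_mult nabla_fun_scale_left algebra_simps)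

text \<open>
  The Hamiltonian fields of two coordinates have as their bracket the Hamiltonian field of a Poisson
  bracket of coordinates; this is the Jacobi identity.
\<close>

lemma tangent_bracket_hamiltonian: "bracket (hamiltonian a) (hamiltonian b) \<in> tangent"
proof -
  have "bracket (hamiltonian a) (hamiltonian b) $ i = br (coord i) (br (coord b) (coord a))" for i
  proof -
    have "bracket (hamiltonian a) (hamiltonian b) $ i =
        br (br (coord i) (coord b)) (coord a) - br (br (coord i) (coord a)) (coord b)"
      unfolding bracket_def nabla_fun_hamiltonian by (simp add: hamiltonian_def PP_def)
    also have "br (br (coord i) (coord b)) (coord a) = - br (coord a) (br (coord i) (coord b))"
      by (rule br_antisym)
    also have "br (br (coord i) (coord a)) (coord b) = br (coord b) (br (coord a) (coord i))"
      unfolding br_antisym[of _ "coord b"] br_antisym[of "coord i" "coord a"] br_minus_right by simp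
    also have "- br (coord a) (br (coord i) (coord b)) - br (coord b) (br (coord a) (coord i)) =
        - (br (coord b) (br (coord a) (coord i)) + br (coord a) (br (coord i) (coord b)))"
      by simp
    also have "\<dots> = br (coord i) (br (coord b) (coord a))"
      using br_jacobi[of "coord i" "coord b" "coord a"]
      by (simp only: neg_eq_iff_add_eq_0 add_ac)
    finally show ?thesis .
  qed
  moreover have "(\<Sum>k\<in>UNIV. DD2 i k * br (coord k) u) = br (coord i) u" for i u
    unfolding br_antisym[of _ u] DD2_sym[of i]
    using br_coord_DD2[of u i] by (simp add: sum_negf mult.commute)
  ultimately show ?thesis
    by (simp add: tangent_iff vec_eq_iff proj_def)
qed

text \<open>
  Integrability of the leaves. The bracket is additive in each argument, and
  \<open>[f X, Y]\<close> differs from \<open>f [X, Y]\<close> by a multiple of \<open>X\<close>; hence it is enough to bracket the spanning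
  Hamiltonian fields.
\<close>

lemma tangent_bracket:
  assumes "X \<in> tangent" "Y \<in> tangent"
  shows "bracket X Y \<in> tangent"
proof -
  have extend: "bracket X Y \<in> tangent"
    if "X \<in> tangent" "Y \<in> tangent" "\<And>a. bracket (hamiltonian a) Y \<in> tangent" for X Y
    using that(1)
    by (induction rule: hamiltonian_induct)
       (auto simp: bracket_add_left bracket_scale_left that
         intro: tangent_add tangent_diff tangent_scale)
  have "bracket X (hamiltonian b) \<in> tangent" if "X \<in> tangent" for X b
    using that tangent_hamiltonian tangent_bracket_hamiltonian by (rule extend)
  from tangent_diff[OF tangent_zero this] assms(2)
  have "bracket (hamiltonian b) Y \<in> tangent" for b
    unfolding bracket_swap[of "hamiltonian b" Y] by simp
  with assms show ?thesis by (rule extend)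
qed

text \<open>
  Both sides are derivations, and they agree on \<open>x\<^sup>i\<close> since a tangent field sends \<open>x\<^sup>i\<close> to its
  \<open>i\<close>-th component; for the bracket this uses that it is again tangent.
\<close>

lemma nabla_fun_bracket:
  assumes "X \<in> tangent" "Y \<in> tangent"
  shows "nabla_fun (bracket X Y) u = nabla_fun X (nabla_fun Y u) - nabla_fun Y (nabla_fun X u)"
proof -
  define d where "d u = nabla_fun X (nabla_fun Y u) - nabla_fun Y (nabla_fun X u)
    - nabla_fun (bracket X Y) u" for u
  have "d u = 0"
  proof (rule derivation_eq_zero[of d])
    show "d (u + v) = d u + d v" for u v
      by (simp add: d_def nabla_fun_add)
    show "d (u * v) = d u * v + u * d v" for u v
      by (simp add: d_def nabla_fun_mult nabla_fun_add algebra_simps)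
    show "d (coord i) = 0" for i
      using assms tangent_bracket[OF assms]
      by (simp add: d_def nabla_fun_coord tangent_iff) (simp add: bracket_def)
  qed (simp add: d_def nabla_fun_scalar)
  then show ?thesis by (simp add: d_def)
qed

section \<open>The Levi-Civita connection and the symmetries of its curvature\<close>

definition dirderiv :: "'m vfield \<Rightarrow> 'm vfield \<Rightarrow> 'm vfield" where
  "dirderiv X Y = (\<chi> i. nabla_fun X (Y $ i))"

lemma nabla_eq: "nabla X Y = proj (dirderiv X Y)"
  by (simp add: nabla_def proj_def dirderiv_def nabla_fun_def sum_distrib_left mult.assoc)

lemma bracket_eq: "bracket X Y = dirderiv X Y - dirderiv Y X"
  by (simp add: bracket_def dirderiv_def vec_eq_iff)

lemma dirderiv_form: "nabla_fun X (form Y Z) = form (dirderiv X Y) Z + form Y (dirderiv X Z)"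
  by (simp add: form_def dirderiv_def nabla_fun_sum nabla_fun_mult sum.distrib)

lemma tangent_nabla: "nabla X Y \<in> tangent"
  by (simp add: nabla_eq tangent_proj)

lemma nabla_add_left: "nabla (X + X') Y = nabla X Y + nabla X' Y"
proof -
  have "dirderiv (X + X') Y = dirderiv X Y + dirderiv X' Y"
    by (simp add: dirderiv_def vec_eq_iff nabla_fun_add_left)
  then show ?thesis by (simp add: nabla_eq proj_add)
qed

lemma nabla_scale_left: "nabla (f *s X) Y = f *s nabla X Y"
proof -
  have "dirderiv (f *s X) Y = f *s dirderiv X Y"
    by (simp add: dirderiv_def vec_eq_iff nabla_fun_scale_left)
  then show ?thesis by (simp add: nabla_eq proj_scale)
qed

lemma nabla_add: "nabla X (Y + Z) = nabla X Y + nabla X Z"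
proof -
  have "dirderiv X (Y + Z) = dirderiv X Y + dirderiv X Z"
    by (simp add: dirderiv_def vec_eq_iff nabla_fun_add)
  then show ?thesis by (simp add: nabla_eq proj_add)
qed

lemma nabla_scale:
  assumes "Y \<in> tangent"
  shows "nabla X (f *s Y) = nabla_fun X f *s Y + f *s nabla X Y"
proof -
  have "dirderiv X (f *s Y) = nabla_fun X f *s Y + f *s dirderiv X Y"
    by (simp add: dirderiv_def vec_eq_iff nabla_fun_mult)
  then show ?thesis
    using assms by (simp add: nabla_eq proj_scale proj_add tangent_iff)
qed

lemma nabla_zero_left [simp]: "nabla 0 Y = 0"
  using nabla_add_left[of 0 0 Y] by simp

lemma nabla_zero [simp]: "nabla X 0 = 0"
  using nabla_add[of X 0 0] by simp

lemma nabla_diff_left: "nabla (X - X') Y = nabla X Y - nabla X' Y"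
  using nabla_add_left[of "X - X'" X' Y] by simp

lemma nabla_diff: "nabla X (Y - Z) = nabla X Y - nabla X Z"
  using nabla_add[of X "Y - Z" Z] by simp

lemma nabla_metric:
  assumes "Y \<in> tangent" "Z \<in> tangent"
  shows "nabla_fun X (form Y Z) = form (nabla X Y) Z + form Y (nabla X Z)"
  using assms form_proj[of "dirderiv X Y" Z] form_proj[of Y "dirderiv X Z"]
  by (simp add: dirderiv_form nabla_eq tangent_iff)

lemma nabla_torsion_free:
  assumes "X \<in> tangent" "Y \<in> tangent"
  shows "nabla X Y - nabla Y X = bracket X Y"
  using tangent_bracket[OF assms] by (simp add: nabla_eq tangent_iff bracket_eq flip: proj_diff)

lemma bracket_jacobi:
  assumes "X \<in> tangent" "Y \<in> tangent" "Z \<in> tangent"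
  shows "bracket X (bracket Y Z) + bracket Y (bracket Z X) + bracket Z (bracket X Y) = 0"
proof -
  have "bracket U (bracket V W) $ i =
      nabla_fun U (nabla_fun V (W $ i)) - nabla_fun U (nabla_fun W (V $ i))
      - (nabla_fun V (nabla_fun W (U $ i)) - nabla_fun W (nabla_fun V (U $ i)))"
    if "V \<in> tangent" "W \<in> tangent" for U V W i
    unfolding nabla_fun_bracket[OF that, symmetric]
    by (simp add: bracket_def[of U] nabla_fun_diff) (simp add: bracket_def nabla_fun_diff)
  then show ?thesis
    using assms by (simp add: vec_eq_iff)
qed

lemma tangent_curvature: "curvature X Y Z \<in> tangent"
  by (simp add: curvature_def tangent_diff tangent_nabla)

lemma curvature_swap: "curvature Y X Z = - curvature X Y Z"
  using nabla_diff_left[of 0 "bracket X Y" Z]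
  by (simp add: curvature_def bracket_swap[of Y X])

lemma curvature_add_left: "curvature (X + X') Y Z = curvature X Y Z + curvature X' Y Z"
  by (simp add: curvature_def nabla_add nabla_add_left bracket_add_left)

lemma curvature_add_right: "curvature X (Y + Y') Z = curvature X Y Z + curvature X Y' Z"
  unfolding curvature_swap[of X] curvature_add_left by simp

lemma curvature_add: "curvature X Y (Z + Z') = curvature X Y Z + curvature X Y Z'"
  by (simp add: curvature_def nabla_add)

text \<open>
  The derivatives of \<open>f\<close> produced by \<open>nabla Y\<close> and by the bracket cancel.
\<close>

lemma curvature_scale_left: "curvature (f *s X) Y Z = f *s curvature X Y Z"
  by (simp add: curvature_def nabla_scale tangent_nabla nabla_scale_left bracket_scale_left
      nabla_diff_left vec_eq_iff algebra_simps)

text \<open>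
  Differentiate \<open>(Z, W)\<close> twice with the metric property. The mixed terms are symmetric in \<open>X\<close> and \<open>Y\<close>,
  and the commutator of the two derivatives of a function is the derivative along the bracket.
\<close>

lemma curvature_skew:
  assumes "X \<in> tangent" "Y \<in> tangent" "Z \<in> tangent" "W \<in> tangent"
  shows "form (curvature X Y Z) W = - form (curvature X Y W) Z"
proof -
  have second: "nabla_fun X (nabla_fun Y (form Z W)) =
      form (nabla X (nabla Y Z)) W + form (nabla Y Z) (nabla X W)
      + form (nabla X Z) (nabla Y W) + form Z (nabla X (nabla Y W))" for X Y
    using assms by (simp add: nabla_metric nabla_fun_add tangent_nabla)
  have "nabla_fun (bracket X Y) (form Z W) =
      form (nabla (bracket X Y) Z) W + form Z (nabla (bracket X Y) W)"
    using assms by (simp add: nabla_metric)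
  then have "form (curvature X Y Z) W + form Z (curvature X Y W) = 0"
    by (simp add: curvature_def form_diff_left form_diff_right nabla_fun_bracket assms second
        form_add_left form_add_right algebra_simps)
  then show ?thesis by (simp add: form_commute eq_neg_iff_add_eq_0)
qed

text \<open>
  Torsion-freeness collapses the cyclic sum to that of \<open>[X, [Y, Z]]\<close>.
\<close>

lemma bianchi_first:
  assumes "X \<in> tangent" "Y \<in> tangent" "Z \<in> tangent"
  shows "curvature X Y Z + curvature Y Z X + curvature Z X Y = 0"
proof -
  have cyc: "nabla U (nabla V W) - nabla U (nabla W V) - nabla (bracket V W) U
      = bracket U (bracket V W)" if "U \<in> tangent" "V \<in> tangent" "W \<in> tangent" for U V W
    using that by (simp add: nabla_torsion_free tangent_bracket flip: nabla_diff)
  have "curvature X Y Z + curvature Y Z X + curvature Z X Y =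
      (nabla X (nabla Y Z) - nabla X (nabla Z Y) - nabla (bracket Y Z) X)
      + (nabla Y (nabla Z X) - nabla Y (nabla X Z) - nabla (bracket Z X) Y)
      + (nabla Z (nabla X Y) - nabla Z (nabla Y X) - nabla (bracket X Y) Z)"
    by (simp add: curvature_def)
  also have "\<dots> = 0"
    using assms by (simp add: cyc bracket_jacobi)
  finally show ?thesis .
qed

text \<open>
  The Jacobi identity for the operators \<open>nabla X\<close>, \<open>nabla Y\<close>, \<open>nabla Z\<close>, in which each commutator of two
  of them is written as a curvature plus the derivative along the bracket. The covariant derivative
  of the curvature tensor is kept in this expanded form, so that no tensor derivative is required.
\<close>

lemma bianchi_second:
  assumes "X \<in> tangent" "Y \<in> tangent" "Z \<in> tangent"
  shows "(nabla X (curvature Y Z W) - curvature Y Z (nabla X W) + curvature X (bracket Y Z) W)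
    + (nabla Y (curvature Z X W) - curvature Z X (nabla Y W) + curvature Y (bracket Z X) W)
    + (nabla Z (curvature X Y W) - curvature X Y (nabla Z W) + curvature Z (bracket X Y) W) = 0"
    (is "?L = 0")
proof -
  have "?L = - (nabla (bracket X (bracket Y Z)) W + nabla (bracket Y (bracket Z X)) W
      + nabla (bracket Z (bracket X Y)) W)"
    by (simp add: curvature_def nabla_diff)
  also have "\<dots> = - nabla (bracket X (bracket Y Z) + bracket Y (bracket Z X)
      + bracket Z (bracket X Y)) W"
    by (simp only: nabla_add_left)
  finally show ?thesis by (simp only: bracket_jacobi[OF assms] nabla_zero_left neg_equal_zero minus_zero)
qed

section \<open>Constant sectional curvature\<close>

text \<open>
  Polarizing \<open>gram Z Y = 0\<close> in \<open>Z\<close> gives \<open>(Y,Y)(Z,W) = (Z,Y)(W,Y)\<close> for all tangent \<open>W\<close>, and the form is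
  nondegenerate.
\<close>

lemma parallel_if_gram_vanishes:
  assumes "Y \<in> tangent" "\<And>Z. Z \<in> tangent \<Longrightarrow> gram Z Y = 0" "Z \<in> tangent"
  shows "form Y Y *s Z = form Z Y *s Y"
proof -
  have polar: "form Y Y * form Z W = form Z Y * form W Y" if "W \<in> tangent" for W
  proof -
    have "gram (Z + W) Y = 0" "gram Z Y = 0" "gram W Y = 0"
      using assms that by (auto intro: tangent_add)
    moreover have "gram (Z + W) Y = gram Z Y + gram W Y
        + 2 * (form Y Y * form Z W - form Z Y * form W Y)"
      unfolding gram_def form_linear form_commute[of W Z]
      by (simp add: power2_eq_square algebra_simps)
    ultimately show ?thesis by simp
  qed
  have "form Y Y *s Z - form Z Y *s Y = 0"
  proof (rule form_tangent_eq_zero)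
    show "form (form Y Y *s Z - form Z Y *s Y) W = 0" if "W \<in> tangent" for W
      using polar[OF that] by (simp add: form_linear form_commute[of Y W])
  qed (intro tangent_diff tangent_scale assms)
  then show ?thesis by simp
qed

lemma ex_tangent_outside_span:
  assumes "finite S" "card S < geometric_dim"
  shows "\<exists>Z \<in> tangent. Z \<notin> vec.span S"
proof (rule ccontr)
  assume "\<not> ?thesis"
  then have "tangent \<subseteq> vec.span S" by blast
  then have "geometric_dim \<le> card S"
    unfolding geometric_dim_def using assms(1) by (rule vec.dim_le_card)
  with assms(2) show False by simp
qed

text \<open>
  Otherwise \<open>(Y,Y) Z = (Z,Y) Y\<close> for all tangent \<open>Z\<close>. If \<open>Y\<close> is isotropic it is then orthogonal to the
  whole tangent space, hence zero; if not, it spans the tangent space.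
\<close>

lemma ex_gram_nonzero:
  assumes dim: "geometric_dim \<ge> 2" and Y: "Y \<in> tangent" "Y \<noteq> 0"
  shows "\<exists>Z \<in> tangent. gram Z Y \<noteq> 0"
proof (rule ccontr)
  assume "\<not> ?thesis"
  then have eq: "form Y Y *s Z = form Z Y *s Y" if "Z \<in> tangent" for Z
    using parallel_if_gram_vanishes Y that by blast
  show False
  proof (cases "form Y Y = 0")
    case True
    have "Y = 0"
    proof (rule form_tangent_eq_zero[OF Y(1)])
      show "form Y Z = 0" if "Z \<in> tangent" for Z
        using eq[OF that] True Y(2) by (simp add: form_commute)
    qed
    with Y(2) show False by simp
  next
    case False
    have "card {Y} < geometric_dim" using dim by simp
    then obtain Z where Z: "Z \<in> tangent" "Z \<notin> vec.span {Y}"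
      using ex_tangent_outside_span[of "{Y}"] by auto
    have "Z = (form Z Y / form Y Y) *s Y"
      using eq[OF Z(1)] False by (simp add: vec_eq_iff field_simps)
    then have "Z \<in> vec.span {Y}"
      by (metis vec.span_base vec.span_scale singletonI)
    with Z(2) show False by simp
  qed
qed

text \<open>
  Move \<open>X\<close> along a line \<open>X + t Z\<close> with \<open>gram Z Y \<noteq> 0\<close>. Both sides are quadratic in \<open>t\<close>, the Gram
  determinant is a quadratic with leading coefficient \<open>gram Z Y\<close>, and the identity holds wherever
  that quadratic does not vanish; so it also holds at \<open>t = 0\<close>.
\<close>

lemma sectional_identity_dense:
  assumes dim: "geometric_dim \<ge> 2"
    and sec: "\<And>X Y. X \<in> tangent \<Longrightarrow> Y \<in> tangent \<Longrightarrow> gram X Y \<noteq> 0 \<Longrightarrow> sectional X Y = k"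
    and XY: "X \<in> tangent" "Y \<in> tangent"
  shows "form (curvature X Y Y) X = k * gram X Y"
proof (cases "Y = 0")
  case True
  have "curvature X 0 0 = 0" by (simp add: curvature_def)
  then show ?thesis by (simp add: True gram_def)
next
  case False
  obtain Z where Z: "Z \<in> tangent" "gram Z Y \<noteq> 0"
    using ex_gram_nonzero[OF dim XY(2) False] by blast
  \<comment> \<open>The coefficients of \<open>t\<close> in the two quadratics.\<close>
  define g1 where "g1 = 2 * (form X Z * form Y Y - form X Y * form Z Y)"
  define c1 where "c1 = form (curvature X Y Y) Z + form (curvature Z Y Y) X"
  have gram: "gram (X + t *s Z) Y = gram X Y + g1 * t + gram Z Y * t\<^sup>2" for t
    unfolding gram_def g1_def form_linear form_commute[of Z X]
    by (simp add: power2_eq_square algebra_simps)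
  have curv: "form (curvature (X + t *s Z) Y Y) (X + t *s Z) =
      form (curvature X Y Y) X + c1 * t + form (curvature Z Y Y) Z * t\<^sup>2" for t
    unfolding curvature_add_left curvature_scale_left form_linear c1_def
    by (simp add: power2_eq_square algebra_simps)
  have "form (curvature X Y Y) X - k * gram X Y = 0"
  proof (rule quadratic_vanishing_off_zeros[OF Z(2)])
    fix t
    assume "gram X Y + g1 * t + gram Z Y * t\<^sup>2 \<noteq> 0"
    then have nz: "gram (X + t *s Z) Y \<noteq> 0" by (simp only: gram not_False_eq_True)
    have "sectional (X + t *s Z) Y = k"
      by (intro sec nz XY tangent_add tangent_scale Z)
    then have "form (curvature (X + t *s Z) Y Y) (X + t *s Z) = k * gram (X + t *s Z) Y"
      using nz by (simp add: sectional_def curvature4_def field_simps)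
    then show "form (curvature X Y Y) X - k * gram X Y + (c1 - k * g1) * t
        + (form (curvature Z Y Y) Z - k * gram Z Y) * t\<^sup>2 = 0"
      unfolding gram curv by (simp add: algebra_simps)
  qed
  then show ?thesis by simp
qed

text \<open>
  The difference of the two sides, paired with a fourth vector, is a tensor with the symmetries of a
  curvature tensor and vanishing sectional values.
\<close>

lemma curvature_of_constant_sectional:
  assumes dim: "geometric_dim \<ge> 2"
    and sec: "\<And>X Y. X \<in> tangent \<Longrightarrow> Y \<in> tangent \<Longrightarrow> gram X Y \<noteq> 0 \<Longrightarrow> sectional X Y = k"
    and XYZ: "X \<in> tangent" "Y \<in> tangent" "Z \<in> tangent"
  shows "curvature X Y Z = k *s (form Y Z *s X - form X Z *s Y)"
proof -
  define G where "G X Y Z = k *s (form Y Z *s X - form X Z *s Y)" for X Y Z :: "'m vfield"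
  define B where "B X Y Z V = form (curvature X Y Z - G X Y Z) V" for X Y Z V
  have formG: "form (G X Y Z) V = k * (form Y Z * form X V - form X Z * form Y V)" for X Y Z V
    by (simp add: G_def form_linear right_diff_distrib)
  have B: "B X Y Z V = form (curvature X Y Z) V
      - k * (form Y Z * form X V - form X Z * form Y V)" for X Y Z V
    by (simp add: B_def form_diff_left formG)
  have minus: "form (- U) V = - form U V" for U V :: "'m vfield"
    using form_diff_left[of 0 U V] by simp
  have "B X Y Z V = 0" if "V \<in> tangent" for V
  proof (rule curvature_tensor_eq_zero[of tangent B, OF tangent_add])
    fix X Y Z V assume tan: "X \<in> tangent" "Y \<in> tangent" "Z \<in> tangent" "V \<in> tangent"
    show "B Y X Z V = - B X Y Z V"
      unfolding B curvature_swap[of X Y] minus by (simp add: algebra_simps)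
    show "B X Y V Z = - B X Y Z V"
      unfolding B curvature_skew[OF tan] by (simp add: algebra_simps)
    have "form (curvature X Y Z) V + form (curvature Y Z X) V + form (curvature Z X Y) V = 0"
      using bianchi_first[OF tan(1-3)] by (simp flip: form_add_left)
    then show "B X Y Z V + B Y Z X V + B Z X Y V = 0"
      unfolding B form_commute[of Y X] form_commute[of Z X] form_commute[of Z Y]
      by (simp add: algebra_simps)
  next
    fix X Y assume "X \<in> tangent" "Y \<in> tangent"
    then show "B X Y Y X = 0"
      using sectional_identity_dense[OF dim sec]
      by (simp add: B gram_def power2_eq_square form_commute[of Y X] algebra_simps)
  qed (use XYZ that in \<open>simp_all add: B curvature_add_right curvature_add form_linear algebra_simps\<close>)
  then have "curvature X Y Z - G X Y Z = 0"
    using XYZ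
    by (intro form_tangent_eq_zero)
       (auto simp: B_def G_def intro!: tangent_diff tangent_scale tangent_curvature)
  then show ?thesis by (simp add: G_def)
qed

text \<open>
  In the second Bianchi identity for this curvature, all terms that contain \<open>k\<close> itself cancel, because
  the form is parallel and the connection has no torsion. What remains is linear in the
  derivatives of \<open>k\<close>.
\<close>

lemma schur_cyclic:
  assumes curv: "\<And>X Y Z. X \<in> tangent \<Longrightarrow> Y \<in> tangent \<Longrightarrow> Z \<in> tangent \<Longrightarrow>
      curvature X Y Z = k *s (form Y Z *s X - form X Z *s Y)"
    and tan: "X \<in> tangent" "Y \<in> tangent" "Z \<in> tangent" "W \<in> tangent"
  shows "nabla_fun X k *s (form Z W *s Y - form Y W *s Z)
    + nabla_fun Y k *s (form X W *s Z - form Z W *s X)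
    + nabla_fun Z k *s (form Y W *s X - form X W *s Y) = 0"
proof -
  have cyc: "nabla U (curvature V T W) - curvature V T (nabla U W) + curvature U (bracket V T) W =
      nabla_fun U k *s (form T W *s V - form V W *s T)
      + k *s (form (nabla U T) W *s V + form T W *s nabla U V
        - form (nabla U V) W *s T - form V W *s nabla U T
        + (form (nabla V T) W - form (nabla T V) W) *s U
        - form U W *s (nabla V T - nabla T V))"
    if uvt: "U \<in> tangent" "V \<in> tangent" "T \<in> tangent" for U V T
  proof -
    have deriv: "nabla U (curvature V T W) = nabla_fun U k *s (form T W *s V - form V W *s T)
      + k *s (nabla_fun U (form T W) *s V + form T W *s nabla U V
        - (nabla_fun U (form V W) *s T + form V W *s nabla U T))"
      using uvt tan by (simp add: curv nabla_scale nabla_diff tangent_diff tangent_scale nabla_fun_mult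
          vec_eq_iff algebra_simps)
    have metric: "nabla_fun U (form T W) = form (nabla U T) W + form T (nabla U W)"
      "nabla_fun U (form V W) = form (nabla U V) W + form V (nabla U W)"
      using uvt tan by (simp_all add: nabla_metric)
    have rotate: "curvature V T (nabla U W) =
        k *s (form T (nabla U W) *s V - form V (nabla U W) *s T)"
      using uvt by (simp add: curv tangent_nabla)
    have torsion: "curvature U (bracket V T) W =
        k *s ((form (nabla V T) W - form (nabla T V) W) *s U - form U W *s (nabla V T - nabla T V))"
      using uvt tan
      by (simp add: curv tangent_bracket tangent_diff tangent_nabla form_diff_left
          flip: nabla_torsion_free)
    show ?thesis
      unfolding deriv metric rotate torsion by (simp add: vec_eq_iff algebra_simps)
  qed
  show ?thesis
    using bianchi_second[OF tan(1-3), of W]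
    unfolding cyc[OF tan(1,2,3)] cyc[OF tan(2,3,1)] cyc[OF tan(3,1,2)]
    by (simp add: vec_eq_iff algebra_simps)
qed

text \<open>
  Choose \<open>Y\<close> and \<open>Z\<close> so that \<open>X, Y, Z\<close> is independent (for \<open>X \<noteq> 0\<close>). In the cyclic identity the
  coefficient of \<open>Z\<close> must vanish for every \<open>W\<close>, that is, \<open>Y(k) X = X(k) Y\<close> by nondegeneracy; since \<open>Y\<close>
  is not a multiple of \<open>X\<close>, this forces \<open>X(k) = 0\<close>.
\<close>

lemma schur:
  assumes dim: "geometric_dim \<ge> 3"
    and curv: "\<And>X Y Z. X \<in> tangent \<Longrightarrow> Y \<in> tangent \<Longrightarrow> Z \<in> tangent \<Longrightarrow>
      curvature X Y Z = k *s (form Y Z *s X - form X Z *s Y)"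
    and X: "X \<in> tangent"
  shows "nabla_fun X k = 0"
proof -
  have "card {X} < geometric_dim" using dim by simp
  then obtain Y where Y: "Y \<in> tangent" "Y \<notin> vec.span {X}"
    using ex_tangent_outside_span[of "{X}"] by auto
  have "card {X, Y} < geometric_dim" using dim card_insert_le_m1[of 2 "{Y}" X] by simp
  then obtain Z where Z: "Z \<in> tangent" "Z \<notin> vec.span {X, Y}"
    using ex_tangent_outside_span[of "{X, Y}"] by auto
  have coeff: "nabla_fun Y k * form X W = nabla_fun X k * form Y W" if W: "W \<in> tangent" for W
  proof (rule ccontr)
    \<comment> \<open>Up to sign, the coefficients of \<open>Z\<close>, \<open>X\<close> and \<open>Y\<close> in the cyclic identity.\<close>
    define c where "c = nabla_fun X k * form Y W - nabla_fun Y k * form X W"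
    define a where "a = nabla_fun Z k * form Y W - nabla_fun Y k * form Z W"
    define b where "b = nabla_fun X k * form Z W - nabla_fun Z k * form X W"
    assume "\<not> ?thesis"
    then have "c \<noteq> 0" by (simp add: c_def)
    have "c *s Z = a *s X + b *s Y"
      using schur_cyclic[OF curv X Y(1) Z(1) W]
      by (simp add: vec_eq_iff a_def b_def c_def algebra_simps)
    then have "Z = (a / c) *s X + (b / c) *s Y"
      using \<open>c \<noteq> 0\<close> by (simp add: vec_eq_iff field_simps)
    moreover have "(a / c) *s X + (b / c) *s Y \<in> vec.span {X, Y}"
      by (intro vec.span_add vec.span_scale vec.span_base) auto
    ultimately show False using Z(2) by simp
  qed
  have "nabla_fun Y k *s X - nabla_fun X k *s Y = 0"
    by (rule form_tangent_eq_zero)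
       (auto simp: form_linear coeff intro!: tangent_diff tangent_scale X Y)
  show ?thesis
  proof (rule ccontr)
    assume nz: "nabla_fun X k \<noteq> 0"
    then have "Y = (nabla_fun Y k / nabla_fun X k) *s X"
      using \<open>nabla_fun Y k *s X - nabla_fun X k *s Y = 0\<close>
      by (simp add: vec_eq_iff field_simps)
    then have "Y \<in> vec.span {X}"
      by (metis vec.span_base vec.span_scale singletonI)
    with Y(2) show False by simp
  qed
qed

lemma casimir_if_tangentially_constant:
  assumes "\<And>X. X \<in> tangent \<Longrightarrow> nabla_fun X k = 0"
  shows "br k u = 0"
  using assms[OF tangent_hamiltonian] by (simp add: br_DD[of k u] nabla_fun_hamiltonian)

end

theorem proposition5p13:
  fixes br :: "'m::{finite,linorder} ratfun \<Rightarrow> 'm ratfun \<Rightarrow> 'm ratfun"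
    and gamma2 k :: "'m ratfun"
  assumes "almost_kaehler_poisson br gamma2"
    and "almost_kaehler_poisson.geometric_dim br gamma2 \<ge> 3"
    and "\<forall>X \<in> almost_kaehler_poisson.tangent br gamma2.
         \<forall>Y \<in> almost_kaehler_poisson.tangent br gamma2.
           gram X Y \<noteq> 0 \<longrightarrow>
           almost_kaehler_poisson.sectional br gamma2 X Y = k"
  shows "\<forall>u. br k u = 0"
proof -
  interpret almost_kaehler_poisson br gamma2 by (fact assms(1))
  have "geometric_dim \<ge> 2" using assms(2) by simp
  then have "nabla_fun X k = 0" if "X \<in> tangent" for X
    using assms(3) that by (intro schur[OF assms(2)] curvature_of_constant_sectional) auto
  then show ?thesis by (simp add: casimir_if_tangentially_constant)
qed

end
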